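(* Let $\Omega$ be a nonempty set. Assume that $Y$ is a Lindenstrauss space and that the nonempty bounded set $M\subseteq\mathcal B(\Omega,Y)$ is pointwise relatively compact. Then $$\omega_{\mathcal B}(M)\le\alpha(M)\le 2\,\omega_{\mathcal B}(M).$$
   Context: A real Banach space $Y$ is a Lindenstrauss space if its dual $Y^*$ is isometric to $L^1(\mu)$ for some measure $\mu$. $\mathcal B=\mathcal B(\Omega,Y)$ is the Banach space of all bounded functions $f:\Omega\to Y$ with norm $\|f\|_\infty=\sup_{x\in\Omega}\|f(x)\|$. For a nonempty bounded subset of a Banach space, the Kuratowski measure of noncompactness $\alpha$ is the infimum of all $\varepsilon>0$ such that the set can be covered by finitely many sets of diameter not greater than $\varepsilon$. $M$ is pointwise relatively compact if $\sup_{x\in\Omega}\alpha(M(x))=0$, where $M(x)=\{f(x):f\in M\}$; equivalently each $M(x)$ is relatively compact in $Y$. $\omega_{\mathcal B}(M)$ is the infimum of all $\varepsilon>0$ for which there are a finite partition $\{A_1,\dots,A_n\}$ of $\Omega$ and a finite set $\{\varphi_1,\dots,\varphi_m\}\subseteq\mathcal B(\Omega,Y)$ such that for every $f\in M$ there is $j\in\{1,\dots,m\}$ with $\operatorname{diam}((f-\varphi_j)(A_i))\le\varepsilon$ for all $i=1,\dots,n$. *)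

theory Defs
  imports "HOL-Analysis.Analysis" "HOL-Library.Disjoint_Sets"
begin

section \<open>The Banach space of bounded functions\<close>

text \<open>
  The type \<open>('w, 'y) bfun\<close> is the space of all bounded functions from \<open>\<Omega>\<close> to \<open>Y\<close>. The
  nonempty set \<open>\<Omega>\<close> is rendered as the universe of the arbitrary type \<open>'w\<close>; no topology
  on \<open>\<Omega>\<close> is involved.
\<close>

typedef (overloaded) ('w, 'y) bfun = "{f :: 'w \<Rightarrow> 'y::real_normed_vector. bounded (range f)}"
  morphisms apply_bfun Bfun
  by (rule exI[of _ "\<lambda>_. 0"]) (simp add: image_constant_conv)

setup_lifting type_definition_bfun

lemma bounded_range_apply_bfun [simp]: "bounded (range (apply_bfun f))"
  using apply_bfun[of f] by simp

lemma bfun_eqI: "(\<And>x. apply_bfun f x = apply_bfun g x) \<Longrightarrow> f = g"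
  by transfer auto

instantiation bfun :: (type, real_normed_vector) real_vector
begin

lift_definition zero_bfun :: "('a, 'b) bfun" is "\<lambda>_. 0"
  by (simp add: image_constant_conv)

lift_definition plus_bfun :: "('a, 'b) bfun \<Rightarrow> ('a, 'b) bfun \<Rightarrow> ('a, 'b) bfun"
  is "\<lambda>f g x. f x + g x" by (rule bounded_plus_comp)

lift_definition minus_bfun :: "('a, 'b) bfun \<Rightarrow> ('a, 'b) bfun \<Rightarrow> ('a, 'b) bfun"
  is "\<lambda>f g x. f x - g x" by (rule bounded_minus_comp)

lift_definition uminus_bfun :: "('a, 'b) bfun \<Rightarrow> ('a, 'b) bfun"
  is "\<lambda>f x. - f x" by (simp add: bounded_iff)

lift_definition scaleR_bfun :: "real \<Rightarrow> ('a, 'b) bfun \<Rightarrow> ('a, 'b) bfun"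
  is "\<lambda>c f x. c *\<^sub>R f x" by (rule bounded_scaleR_comp)

lemmas bfun_rep_eq [simp] =
  zero_bfun.rep_eq plus_bfun.rep_eq minus_bfun.rep_eq uminus_bfun.rep_eq scaleR_bfun.rep_eq

instance
  by standard (auto intro!: bfun_eqI simp: algebra_simps)

end

instantiation bfun :: (type, real_normed_vector) real_normed_vector
begin

definition norm_bfun :: "('a, 'b) bfun \<Rightarrow> real"
  where "norm_bfun f = (SUP x. norm (apply_bfun f x))"

definition dist_bfun :: "('a, 'b) bfun \<Rightarrow> ('a, 'b) bfun \<Rightarrow> real"
  where "dist_bfun f g = norm (f - g)"

definition sgn_bfun :: "('a, 'b) bfun \<Rightarrow> ('a, 'b) bfun"
  where "sgn_bfun f = f /\<^sub>R norm f"

definition uniformity_bfun :: "(('a, 'b) bfun \<times> ('a, 'b) bfun) filter"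
  where "uniformity_bfun = (INF e\<in>{0 <..}. principal {(x, y). dist x y < e})"

definition open_bfun :: "('a, 'b) bfun set \<Rightarrow> bool"
  where "open_bfun S = (\<forall>x\<in>S. \<forall>\<^sub>F (x', y) in uniformity. x' = x \<longrightarrow> y \<in> S)"

lemma norm_apply_bfun_le: "norm (apply_bfun f x) \<le> norm f"
  unfolding norm_bfun_def
  by (rule cSUP_upper) (auto intro!: bounded_imp_bdd_above simp: bounded_norm_comp)

lemma norm_bfun_le: "(\<And>x. norm (apply_bfun f x) \<le> b) \<Longrightarrow> norm f \<le> b"
  unfolding norm_bfun_def by (rule cSUP_least) auto

instance
proof
  fix f g :: "('a, 'b) bfun" and c :: real
  have nonneg: "0 \<le> norm h" for h :: "('a, 'b) bfun"
    by (rule order_trans[OF norm_ge_zero norm_apply_bfun_le])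
  show "norm f = 0 \<longleftrightarrow> f = 0"
  proof
    assume "norm f = 0"
    then show "f = 0"
      using norm_apply_bfun_le[of f] by (auto intro!: bfun_eqI)
  next
    assume "f = 0"
    then show "norm f = 0"
      using norm_bfun_le[of f 0] nonneg[of f] by auto
  qed
  show "norm (f + g) \<le> norm f + norm g"
    by (rule norm_bfun_le) (auto intro!: norm_triangle_le add_mono norm_apply_bfun_le)
  have le: "norm (a *\<^sub>R h) \<le> \<bar>a\<bar> * norm h" for a and h :: "('a, 'b) bfun"
    by (rule norm_bfun_le) (auto intro!: mult_left_mono norm_apply_bfun_le)
  show "norm (c *\<^sub>R f) = \<bar>c\<bar> * norm f"
  proof (cases "c = 0")
    case True
    then show ?thesis using le[of 0 f] nonneg[of "0 *\<^sub>R f"] by auto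
  next
    case False
    have "norm f \<le> \<bar>inverse c\<bar> * norm (c *\<^sub>R f)"
      using le[of "inverse c" "c *\<^sub>R f"] False by simp
    then have "\<bar>c\<bar> * norm f \<le> norm (c *\<^sub>R f)"
      using False by (simp add: field_simps)
    with le[of c f] show ?thesis by simp
  qed
qed (rule dist_bfun_def sgn_bfun_def uniformity_bfun_def open_bfun_def)+

end

instance bfun :: (type, banach) banach
proof
  fix F :: "nat \<Rightarrow> ('a, 'b) bfun"
  assume C: "Cauchy F"
  have pw: "dist (apply_bfun f x) (apply_bfun g x) \<le> dist f g" for f g :: "('a, 'b) bfun" and x
    using norm_apply_bfun_le[of "f - g" x] by (simp add: dist_norm)
  have "Cauchy (\<lambda>n. apply_bfun (F n) x)" for x
  proof (rule metric_CauchyI)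
    fix e :: real assume "e > 0"
    then obtain N where "\<forall>m\<ge>N. \<forall>n\<ge>N. dist (F m) (F n) < e"
      using metric_CauchyD[OF C \<open>e > 0\<close>] by blast
    then have "\<forall>m\<ge>N. \<forall>n\<ge>N. dist (apply_bfun (F m) x) (apply_bfun (F n) x) < e"
      using le_less_trans[OF pw] by auto
    then show "\<exists>N. \<forall>m\<ge>N. \<forall>n\<ge>N. dist (apply_bfun (F m) x) (apply_bfun (F n) x) < e" ..
  qed
  then have "\<forall>x. \<exists>y. (\<lambda>n. apply_bfun (F n) x) \<longlonglongrightarrow> y"
    by (simp add: Cauchy_convergent_iff convergent_def)
  then have "\<exists>l. \<forall>x. (\<lambda>n. apply_bfun (F n) x) \<longlonglongrightarrow> l x"
    by (rule choice)
  then obtain l where l: "\<And>x. (\<lambda>n. apply_bfun (F n) x) \<longlonglongrightarrow> l x"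
    by blast
  have unif: "\<exists>N. \<forall>n\<ge>N. \<forall>x. norm (apply_bfun (F n) x - l x) \<le> e" if "e > 0" for e
  proof -
    obtain N where N: "\<And>m n. m \<ge> N \<Longrightarrow> n \<ge> N \<Longrightarrow> dist (F m) (F n) < e"
      using metric_CauchyD[OF C \<open>e > 0\<close>] by blast
    have "norm (apply_bfun (F n) x - l x) \<le> e" if "n \<ge> N" for n x
    proof (rule tendsto_upperbound)
      show "(\<lambda>m. norm (apply_bfun (F n) x - apply_bfun (F m) x))
              \<longlonglongrightarrow> norm (apply_bfun (F n) x - l x)"
        by (intro tendsto_intros l)
      show "\<forall>\<^sub>F m in sequentially. norm (apply_bfun (F n) x - apply_bfun (F m) x) \<le> e"
        using eventually_ge_at_top[of N]
      proof eventually_elim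
        case (elim m)
        then show ?case
          using pw[of "F n" x "F m"] N[OF that elim] by (simp add: dist_norm)
      qed
    qed simp
    then show ?thesis by blast
  qed
  obtain N where N: "\<And>x. norm (apply_bfun (F N) x - l x) \<le> 1"
    using unif[of 1] by auto
  have "norm (l x) \<le> norm (F N) + 1" for x
    using N[of x] norm_apply_bfun_le[of "F N" x] norm_triangle_ineq2[of "l x" "apply_bfun (F N) x"]
    by (simp add: norm_minus_commute)
  then have "bounded (range l)"
    by (intro boundedI) auto
  then obtain L where L: "apply_bfun L = l"
    by (metis Bfun_inverse mem_Collect_eq)
  have "F \<longlonglongrightarrow> L"
  proof (rule metric_LIMSEQ_I)
    fix r :: real assume "r > 0"
    then obtain K where "\<forall>n\<ge>K. \<forall>x. norm (apply_bfun (F n) x - l x) \<le> r / 2"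
      using unif[of "r / 2"] by auto
    then have "\<forall>n\<ge>K. norm (F n - L) \<le> r / 2"
      by (intro allI impI norm_bfun_le) (simp only: minus_bfun.rep_eq L)
    then show "\<exists>K. \<forall>n\<ge>K. dist (F n) L < r"
      using \<open>r > 0\<close> by (intro exI[of _ K]) (fastforce simp: dist_norm)
  qed
  then show "convergent F"
    by (rule convergentI)
qed

section \<open>Lindenstrauss spaces\<close>

text \<open>
  Elements of \<open>L\<^sup>1(\<mu>)\<close> are classes of real integrable functions modulo equality almost
  everywhere; the vector space operations and the norm on classes are expressed through
  arbitrary representatives.
\<close>

definition L1_class :: "'b measure \<Rightarrow> ('b \<Rightarrow> real) \<Rightarrow> ('b \<Rightarrow> real) set"
  where "L1_class \<mu> f = {g. integrable \<mu> g \<and> (AE t in \<mu>. g t = f t)}"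

definition L1_space :: "'b measure \<Rightarrow> ('b \<Rightarrow> real) set set"
  where "L1_space \<mu> = L1_class \<mu> ` {f. integrable \<mu> f}"

definition dual_L1_isometry ::
    "'b measure \<Rightarrow> (('y::real_normed_vector \<Rightarrow>\<^sub>L real) \<Rightarrow> ('b \<Rightarrow> real) set) \<Rightarrow> bool"
  where "dual_L1_isometry \<mu> J \<longleftrightarrow>
    bij_betw J UNIV (L1_space \<mu>) \<and>
    (\<forall>\<phi> \<psi>. \<forall>f\<in>J \<phi>. \<forall>g\<in>J \<psi>. (\<lambda>t. f t + g t) \<in> J (\<phi> + \<psi>)) \<and>
    (\<forall>c \<phi>. \<forall>f\<in>J \<phi>. (\<lambda>t. c * f t) \<in> J (c *\<^sub>R \<phi>)) \<and>
    (\<forall>\<phi>. \<forall>f\<in>J \<phi>. (LINT t|\<mu>. \<bar>f t\<bar>) = norm \<phi>)"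

text \<open>
  HOL cannot quantify existentially over the type carrying \<open>\<mu>\<close>, so that type is a parameter
  \<open>'b\<close>. A theorem assuming \<open>lindenstrauss_space TYPE('y) TYPE('b)\<close> with \<open>'b\<close> not occurring
  elsewhere holds for every type \<open>'b\<close>, hence for measures on arbitrary sets.
\<close>

definition lindenstrauss_space :: "'y::banach itself \<Rightarrow> 'b itself \<Rightarrow> bool"
  where "lindenstrauss_space _ _ \<longleftrightarrow>
    (\<exists>(\<mu> :: 'b measure) (J :: ('y \<Rightarrow>\<^sub>L real) \<Rightarrow> ('b \<Rightarrow> real) set). dual_L1_isometry \<mu> J)"

section \<open>Measures of noncompactness\<close>

text \<open>
  The requirement \<open>bounded C\<close> is needed because \<open>diameter\<close> is a real number, hence
  meaningless on unbounded sets, whose true diameter is infinite.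
\<close>

definition kuratowski :: "'a::metric_space set \<Rightarrow> real"
  where "kuratowski S = Inf {\<epsilon>. \<epsilon> > 0 \<and>
    (\<exists>\<C>. finite \<C> \<and> S \<subseteq> \<Union>\<C> \<and> (\<forall>C\<in>\<C>. bounded C \<and> diameter C \<le> \<epsilon>))}"

text \<open>
  The supremum is that of a bounded family whenever \<open>M\<close> is bounded, which is the only case in
  which the notion is used.
\<close>

definition pointwise_relatively_compact :: "('w, 'y::real_normed_vector) bfun set \<Rightarrow> bool"
  where "pointwise_relatively_compact M \<longleftrightarrow>
    (SUP x. kuratowski ((\<lambda>f. apply_bfun f x) ` M)) = 0"

definition omega_B :: "('w, 'y::real_normed_vector) bfun set \<Rightarrow> real"
  where "omega_B M = Inf {\<epsilon>. \<epsilon> > 0 \<and>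
    (\<exists>\<A> \<Phi>. finite \<A> \<and> partition_on (UNIV :: 'w set) \<A> \<and> finite (\<Phi> :: ('w, 'y) bfun set) \<and>
      (\<forall>f\<in>M. \<exists>\<phi>\<in>\<Phi>. \<forall>A\<in>\<A>. diameter (apply_bfun (f - \<phi>) ` A) \<le> \<epsilon>))}"

end

theory Submission
  imports Defs
begin

text \<open>
  If \<open>\<C>\<close> covers \<open>M\<close> by finitely many sets of diameter at most \<open>d\<close>, then each \<open>C(x)\<close> with
  \<open>C \<in> \<C>\<close> is relatively compact, and in a Lindenstrauss space such a set lies in a ball of
  radius \<open>d / 2 + e\<close>. The centers form a function \<open>\<phi>\<close> with \<open>norm (f - \<phi>) \<le> d / 2 + e\<close> on \<open>C\<close>,
  so the trivial partition already shows \<open>\<omega>(M) \<le> \<alpha>(M)\<close>. For the centers, Hahn--Banach duality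
  in a finite power of \<open>Y\<close> bounds the Chebyshev radius of a finite set by \<open>\<Sum> \<phi>\<^sub>i(y\<^sub>i)\<close> with
  \<open>\<Sum> \<phi>\<^sub>i = 0\<close> and \<open>\<Sum> norm \<phi>\<^sub>i \<le> 1\<close>; in \<open>L\<^sup>1\<close> one can write \<open>\<phi>\<^sub>i = \<Sum>\<^sub>j \<psi>\<^sub>i\<^sub>j\<close> with antisymmetric
  \<open>\<psi>\<close> of the same total norm, and the bound becomes \<open>\<Sum> \<psi>\<^sub>i\<^sub>j(y\<^sub>i - y\<^sub>j) / 2\<close>.

  Conversely, if the oscillation of \<open>f - \<phi>\<close> on each part is at most \<open>e\<close>, two functions with
  the same \<open>\<phi>\<close> that are close at one point of each part differ by little more than \<open>2 * e\<close>.
\<close>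

section \<open>The Hahn--Banach theorem\<close>

text \<open>Homogeneity is only required as an inequality; equality and \<open>p 0 = 0\<close> follow by scaling back.\<close>

definition sublinear :: "('v::real_vector \<Rightarrow> real) \<Rightarrow> bool"
  where "sublinear p \<longleftrightarrow>
    (\<forall>x y. p (x + y) \<le> p x + p y) \<and> (\<forall>c>0. \<forall>x. p (c *\<^sub>R x) \<le> c * p x)"

lemma sublinearI:
  assumes "\<And>x y. p (x + y) \<le> p x + p y" and "\<And>c x. c > 0 \<Longrightarrow> p (c *\<^sub>R x) \<le> c * p x"
  shows "sublinear p"
  using assms by (simp add: sublinear_def)

lemma sublinear_add: "sublinear p \<Longrightarrow> p (x + y) \<le> p x + p y"
  by (simp add: sublinear_def)

lemma sublinear_zero:
  assumes "sublinear p"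
  shows "p 0 = 0"
proof -
  have "p (c *\<^sub>R 0) \<le> c * p 0" if "c > 0" for c
    using assms that unfolding sublinear_def by blast
  \<comment> \<open>The factor 2 gives \<open>p 0 \<ge> 0\<close>, the factor 1/2 gives
    \<open>p 0 \<le> 0\<close>.\<close>
  from this[of 2] this[of "1/2"] show ?thesis by simp
qed

lemma sublinear_scale:
  assumes "sublinear p" "c \<ge> 0"
  shows "p (c *\<^sub>R x) = c * p x"
proof (cases "c = 0")
  case True
  then show ?thesis by (simp add: sublinear_zero assms)
next
  case False
  then have "c > 0" using assms by simp
  have le: "p (a *\<^sub>R z) \<le> a * p z" if "a > 0" for a z
    using assms(1) that unfolding sublinear_def by blast
  have "p x \<le> inverse c * p (c *\<^sub>R x)"
    using le[of "inverse c" "c *\<^sub>R x"] \<open>c > 0\<close> by simp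
  then have "c * p x \<le> p (c *\<^sub>R x)"
    using \<open>c > 0\<close> by (simp add: field_simps)
  then show ?thesis
    using le[OF \<open>c > 0\<close>, of x] by simp
qed

lemma sublinear_ge_minus: "sublinear p \<Longrightarrow> - p (- x) \<le> p x"
  using sublinear_add[of p x "- x"] sublinear_zero[of p] by simp

text \<open>
  A sublinear minorant of \<open>p\<close> whose value at \<open>- y\<close> is at most \<open>- p y\<close>. It makes minimal
  sublinear functionals additive, and it makes a dominated linear functional attain \<open>p y\<close>.
\<close>

definition directional :: "('v::real_vector \<Rightarrow> real) \<Rightarrow> 'v \<Rightarrow> 'v \<Rightarrow> real"
  where "directional p y x = (INF t\<in>{0..}. p (x + t *\<^sub>R y) - t * p y)"

lemma directional_le:
  assumes "sublinear p" "t \<ge> 0"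
  shows "directional p y x \<le> p (x + t *\<^sub>R y) - t * p y"
  unfolding directional_def
proof (rule cINF_lower)
  \<comment> \<open>The infimum is finite because \<open>s * p y = p (s *\<^sub>R y) \<le> p (x + s
    *\<^sub>R y) + p (- x)\<close>.\<close>
  show "bdd_below ((\<lambda>t. p (x + t *\<^sub>R y) - t * p y) ` {0..})"
  proof (rule bdd_belowI2)
    fix s :: real assume "s \<in> {0..}"
    then show "- p (- x) \<le> p (x + s *\<^sub>R y) - s * p y"
      using sublinear_add[OF assms(1), of "x + s *\<^sub>R y" "- x"] sublinear_scale[OF assms(1), of s y]
      by simp
  qed
qed (use assms in simp)

lemma directional_greatest:
  "(\<And>t. t \<ge> 0 \<Longrightarrow> b \<le> p (x + t *\<^sub>R y) - t * p y) \<Longrightarrow> b \<le> directional p y x"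
  unfolding directional_def by (rule cINF_greatest) auto

text \<open>Parameters \<open>s\<close> for \<open>x\<close> and \<open>t\<close> for
  \<open>x'\<close> combine to the admissible parameter \<open>s + t\<close> for
  \<open>x + x'\<close>; replacing \<open>t\<close> by \<open>c * t\<close> handles scaling.\<close>

lemma sublinear_directional:
  assumes p: "sublinear p"
  shows "sublinear (directional p y)"
proof (rule sublinearI)
  fix x x'
  have "directional p y (x + x') - directional p y x \<le> directional p y x'"
  proof (rule directional_greatest)
    fix t :: real assume t: "t \<ge> 0"
    have "directional p y (x + x') - (p (x' + t *\<^sub>R y) - t * p y) \<le> directional p y x"
    proof (rule directional_greatest)
      fix s :: real assume s: "s \<ge> 0"
      have "directional p y (x + x') \<le> p (x + x' + (s + t) *\<^sub>R y) - (s + t) * p y"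
        using s t by (intro directional_le p) simp
      also have "p (x + x' + (s + t) *\<^sub>R y) \<le> p (x + s *\<^sub>R y) + p (x' + t *\<^sub>R y)"
        using sublinear_add[OF p, of "x + s *\<^sub>R y" "x' + t *\<^sub>R y"] by (simp add: algebra_simps)
      finally show "directional p y (x + x') - (p (x' + t *\<^sub>R y) - t * p y)
          \<le> p (x + s *\<^sub>R y) - s * p y"
        by (simp add: algebra_simps)
    qed
    then show "directional p y (x + x') - directional p y x \<le> p (x' + t *\<^sub>R y) - t * p y"
      by simp
  qed
  then show "directional p y (x + x') \<le> directional p y x + directional p y x'"
    by simp
next
  fix c :: real and x
  assume c: "c > 0"
  have "directional p y (c *\<^sub>R x) / c \<le> directional p y x"
  proof (rule directional_greatest)
    fix t :: real assume "t \<ge> 0"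
    then have "directional p y (c *\<^sub>R x) \<le> p (c *\<^sub>R x + (c * t) *\<^sub>R y) - (c * t) * p y"
      using c by (intro directional_le p) simp
    also have "p (c *\<^sub>R x + (c * t) *\<^sub>R y) = c * p (x + t *\<^sub>R y)"
      using sublinear_scale[OF p, of c "x + t *\<^sub>R y"] c by (simp add: algebra_simps)
    finally show "directional p y (c *\<^sub>R x) / c \<le> p (x + t *\<^sub>R y) - t * p y"
      using c by (simp add: field_simps)
  qed
  then show "directional p y (c *\<^sub>R x) \<le> c * directional p y x"
    using c by (simp add: field_simps)
qed

lemma directional_le_self: "sublinear p \<Longrightarrow> directional p y x \<le> p x"
  using directional_le[of p 0 y x] by simp

text \<open>Subadditivity involves two members \<open>q\<close> and \<open>r\<close> at once. The
  smaller of them exists by comparability, is subadditive itself and lies below both.\<close>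

lemma sublinear_INF_chain:
  assumes ne: "C \<noteq> {}" and sub: "\<And>q. q \<in> C \<Longrightarrow> sublinear q"
    and chain: "\<And>q r. q \<in> C \<Longrightarrow> r \<in> C \<Longrightarrow> q \<le> r \<or> r \<le> q"
    and bdd: "\<And>x. bdd_below ((\<lambda>q. q x) ` C)"
  shows "sublinear (\<lambda>x. INF q\<in>C. q x)"
proof (rule sublinearI)
  let ?I = "\<lambda>x. INF q\<in>C. q x"
  have low: "?I x \<le> q x" if "q \<in> C" for q x
    using bdd that by (rule cINF_lower)
  {
    fix x y
    have key: "?I (x + y) \<le> q x + r y" if q: "q \<in> C" and r: "r \<in> C" for q r
    proof -
      from chain[OF q r] obtain s where "s \<in> C" "s \<le> q" "s \<le> r"
        using q r by blast
      then show ?thesis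
        using low[of s "x + y"] sublinear_add[OF sub, of s x y]
          le_funD[of s q x] le_funD[of s r y] by simp
    qed
    have "?I (x + y) - ?I x \<le> ?I y"
    proof (rule cINF_greatest[OF ne])
      fix r assume r: "r \<in> C"
      have "?I (x + y) - r y \<le> ?I x"
        using key[OF _ r] by (intro cINF_greatest[OF ne]) (simp add: algebra_simps)
      then show "?I (x + y) - ?I x \<le> r y" by simp
    qed
    then show "?I (x + y) \<le> ?I x + ?I y" by simp
  next
    fix c :: real and x assume c: "c > 0"
    have "?I (c *\<^sub>R x) / c \<le> ?I x"
    proof (rule cINF_greatest[OF ne])
      fix q assume q: "q \<in> C"
      then show "?I (c *\<^sub>R x) / c \<le> q x"
        using low[OF q, of "c *\<^sub>R x"] sublinear_scale[OF sub[OF q], of c x] c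
        by (simp add: field_simps)
    qed
    then show "?I (c *\<^sub>R x) \<le> c * ?I x"
      using c by (simp add: field_simps)
  }
qed

text \<open>Minimality forces \<open>directional q y = q\<close> for every \<open>y\<close>; the
  parameter \<open>t = 1\<close> then gives the reverse of subadditivity.\<close>

lemma minimal_sublinear_linear:
  assumes q: "sublinear q" and min: "\<And>r. sublinear r \<Longrightarrow> r \<le> q \<Longrightarrow> r = q"
  shows "linear q"
proof -
  have add: "q (x + y) = q x + q y" for x y
  proof -
    have "directional q y = q"
      by (rule min) (auto intro!: sublinear_directional directional_le_self q le_funI)
    then have "q x \<le> q (x + y) - q y"
      using directional_le[OF q, of 1 y x] by simp
    then show ?thesis
      using sublinear_add[OF q, of x y] by simp
  qed
  have neg: "q (- x) = - q x" for x
    using add[of x "- x"] sublinear_zero[OF q] by simp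
  have "q (c *\<^sub>R x) = c * q x" for c x
  proof (cases "c \<ge> 0")
    case False
    then show ?thesis
      using sublinear_scale[OF q, of "- c" x] neg[of "c *\<^sub>R x"] by simp
  qed (use sublinear_scale[OF q] in simp)
  then show ?thesis
    using add by (intro linearI) auto
qed

theorem sublinear_dominates_linear:
  assumes p: "sublinear p"
  obtains f where "linear f" "\<And>x. f x \<le> p x"
proof -
  let ?A = "{q. sublinear q \<and> q \<le> p}"
  \<comment> \<open>The order is reversed, so that a maximal element for \<open>?P\<close> is a
    minimal sublinear minorant of \<open>p\<close>.\<close>
  let ?P = "\<lambda>q r :: 'a \<Rightarrow> real. r \<le> q"
  have "\<exists>m\<in>?A. \<forall>q\<in>?A. ?P m q \<longrightarrow> q = m"
  proof (rule predicate_Zorn)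
    show "partial_order_on ?A (relation_of ?P ?A)"
      by (rule partial_order_on_relation_ofI) auto
    fix C assume C: "C \<in> Chains (relation_of ?P ?A)"
    show "\<exists>u\<in>?A. \<forall>q\<in>C. ?P q u"
    proof (cases "C = {}")
      case True
      then show ?thesis using p by auto
    next
      case False
      have sub: "sublinear q" and le: "q \<le> p" if "q \<in> C" for q
        using Chains_relation_of[OF C] that by auto
      \<comment> \<open>Every \<open>q \<le> p\<close> satisfies
        \<open>- p (- x) \<le> - q (- x) \<le> q x\<close>, a bound independent of
        \<open>q\<close>.\<close>
      have bdd: "bdd_below ((\<lambda>q. q x) ` C)" for x
      proof (rule bdd_belowI2)
        fix q assume "q \<in> C"
        then show "- p (- x) \<le> q x"
          using sublinear_ge_minus[OF sub, of q x] le_funD[OF le, of q "- x"] by simp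
      qed
      have chain: "q \<le> r \<or> r \<le> q" if "q \<in> C" "r \<in> C" for q r
        using C that unfolding Chains_def relation_of_def by blast
      let ?I = "\<lambda>x. INF q\<in>C. q x"
      have "?I \<le> q" if "q \<in> C" for q
        using bdd that by (auto intro!: le_funI cINF_lower)
      moreover have "sublinear ?I"
        by (rule sublinear_INF_chain[OF False sub chain bdd])
      ultimately show ?thesis
        using False le by (intro bexI[of _ ?I]) (auto intro: order_trans)
    qed
  qed
  then obtain m where m: "sublinear m" "m \<le> p"
    and min: "\<And>q. sublinear q \<Longrightarrow> q \<le> p \<Longrightarrow> q \<le> m \<Longrightarrow> q = m"
    by auto
  have "linear m"
    by (rule minimal_sublinear_linear[OF m(1)]) (use min m(2) in \<open>auto intro: order_trans\<close>)
  with that show thesis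
    using le_funD[OF m(2)] by blast
qed

corollary sublinear_dominates_linear_attained:
  assumes p: "sublinear p"
  obtains f where "linear f" "\<And>x. f x \<le> p x" "f y = p y"
proof -
  obtain f where f: "linear f" "\<And>x. f x \<le> directional p y x"
    using sublinear_dominates_linear[OF sublinear_directional[OF p]] by blast
  have le: "f x \<le> p x" for x
    using f(2) directional_le_self[OF p] order_trans by blast
  \<comment> \<open>At \<open>- y\<close> the parameter \<open>t = 1\<close> bounds
    \<open>directional p y\<close> by \<open>p 0 - p y\<close>, which linearity turns into
    \<open>p y \<le> f y\<close>.\<close>
  have "f (- y) \<le> - p y"
    using f(2)[of "- y"] directional_le[OF p, of 1 y "- y"] sublinear_zero[OF p] by simp
  then have "f y = p y"
    using le[of y] linear_neg[OF f(1), of y] by simp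
  with f(1) le that show thesis by blast
qed

section \<open>Functionals that realize the distance to a subspace\<close>

lemma infdist_approx:
  assumes "A \<noteq> {}" "e > 0"
  obtains a where "a \<in> A" "dist x a < infdist x A + e"
proof -
  have "(INF a\<in>A. dist x a) < infdist x A + e"
    using assms by (simp add: infdist_notempty)
  then show thesis
    using that assms by (auto simp: cINF_less_iff)
qed

lemma sublinear_infdist:
  fixes W :: "'v::real_normed_vector set"
  assumes W: "subspace W"
  shows "sublinear (\<lambda>x. infdist x W)"
proof (rule sublinearI)
  have ne: "W \<noteq> {}" using subspace_0[OF W] by blast
  fix x y :: 'v
  show "infdist (x + y) W \<le> infdist x W + infdist y W"
  proof (rule field_le_epsilon)
    fix e :: real assume "e > 0"
    obtain a where a: "a \<in> W" "dist x a < infdist x W + e / 2"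
      using infdist_approx[OF ne, of "e / 2"] \<open>e > 0\<close> by auto
    obtain b where b: "b \<in> W" "dist y b < infdist y W + e / 2"
      using infdist_approx[OF ne, of "e / 2"] \<open>e > 0\<close> by auto
    have "infdist (x + y) W \<le> dist (x + y) (a + b)"
      using a b by (intro infdist_le subspace_add[OF W])
    also have "\<dots> \<le> dist x a + dist y b"
      by (rule dist_triangle_add)
    finally show "infdist (x + y) W \<le> infdist x W + infdist y W + e"
      using a b by simp
  qed
next
  have ne: "W \<noteq> {}" using subspace_0[OF W] by blast
  fix c :: real and x :: 'v assume c: "c > 0"
  have "infdist (c *\<^sub>R x) W / c \<le> infdist x W"
  proof (subst (2) infdist_notempty[OF ne], rule cINF_greatest[OF ne])
    fix a assume "a \<in> W"
    then have "infdist (c *\<^sub>R x) W \<le> dist (c *\<^sub>R x) (c *\<^sub>R a)"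
      by (intro infdist_le subspace_scale[OF W])
    also have "\<dots> = c * dist x a"
      using c by (simp add: dist_norm flip: scaleR_diff_right)
    finally show "infdist (c *\<^sub>R x) W / c \<le> dist x a"
      using c by (simp add: field_simps)
  qed
  then show "infdist (c *\<^sub>R x) W \<le> c * infdist x W"
    using c by (simp add: field_simps)
qed

text \<open>Domination by the distance serves both purposes: it is at most the norm, and it vanishes
  at \<open>w\<close> and \<open>- w\<close> for \<open>w \<in> W\<close>, which forces the
  functional to vanish on \<open>W\<close>.\<close>

theorem Hahn_Banach_subspace_distance:
  fixes W :: "'v::real_normed_vector set"
  assumes W: "subspace W"
  obtains F :: "'v \<Rightarrow>\<^sub>L real"
  where "norm F \<le> 1" "\<And>w. w \<in> W \<Longrightarrow> blinfun_apply F w = 0" "blinfun_apply F z = infdist z W"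
proof -
  obtain f where f: "linear f" "\<And>x. f x \<le> infdist x W" "f z = infdist z W"
    using sublinear_dominates_linear_attained[OF sublinear_infdist[OF W]] by blast
  have "infdist x W \<le> norm x" for x
    using infdist_le[OF subspace_0[OF W], of x] by simp
  then have le: "f x \<le> norm x" for x
    using f(2) order_trans by blast
  have bd: "norm (f x) \<le> 1 * norm x" for x
    using le[of x] le[of "- x"] linear_neg[OF f(1), of x] by (simp add: abs_le_iff)
  have "bounded_linear f"
    using f(1) bd by (auto intro!: bounded_linear_intro[where K = 1] simp: linear_add linear_scale)
  then have ap: "blinfun_apply (Blinfun f) = f"
    by (rule bounded_linear_Blinfun_apply)
  show thesis
  proof
    show "norm (Blinfun f) \<le> 1"
      using bd by (intro norm_blinfun_bound) (auto simp: ap)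
    show "blinfun_apply (Blinfun f) z = infdist z W"
      by (simp add: ap f)
    fix w assume w: "w \<in> W"
    have "f w \<le> 0" "f (- w) \<le> 0"
      using f(2)[of w] f(2)[of "- w"] subspace_neg[OF W w] w by auto
    then show "blinfun_apply (Blinfun f) w = 0"
      using linear_neg[OF f(1), of w] by (simp add: ap)
  qed
qed

section \<open>Decomposition in \<open>L\<^sup>1\<close>\<close>

lemma dual_L1_isometry_ex_rep:
  assumes J: "dual_L1_isometry \<mu> J"
  obtains f where "integrable \<mu> f" "f \<in> J \<phi>"
proof -
  have "J \<phi> \<in> L1_space \<mu>"
    using J unfolding dual_L1_isometry_def bij_betw_def by blast
  then show thesis
    using that by (auto simp: L1_space_def L1_class_def)
qed

lemma dual_L1_isometry_ex_functional:
  assumes J: "dual_L1_isometry \<mu> J" and h: "integrable \<mu> h"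
  obtains \<psi> where "h \<in> J \<psi>"
proof -
  have "L1_class \<mu> h \<in> range J"
    using J h unfolding dual_L1_isometry_def bij_betw_def L1_space_def by blast
  then obtain \<psi> where "J \<psi> = L1_class \<mu> h" by auto
  then have "h \<in> J \<psi>" using h by (simp add: L1_class_def)
  then show thesis by (rule that)
qed

lemma dual_L1_isometry_integrable:
  "dual_L1_isometry \<mu> J \<Longrightarrow> f \<in> J \<phi> \<Longrightarrow> integrable \<mu> f"
  unfolding dual_L1_isometry_def bij_betw_def L1_space_def L1_class_def by blast

lemma
  assumes "dual_L1_isometry \<mu> J"
  shows dual_L1_isometry_add: "f \<in> J \<phi> \<Longrightarrow> g \<in> J \<psi> \<Longrightarrow> (\<lambda>t. f t + g t) \<in> J (\<phi> + \<psi>)"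
    and dual_L1_isometry_scale: "f \<in> J \<phi> \<Longrightarrow> (\<lambda>t. c * f t) \<in> J (c *\<^sub>R \<phi>)"
    and dual_L1_isometry_norm: "f \<in> J \<phi> \<Longrightarrow> (LINT t|\<mu>. \<bar>f t\<bar>) = norm \<phi>"
  using assms unfolding dual_L1_isometry_def by blast+

lemma dual_L1_isometry_zero:
  assumes J: "dual_L1_isometry \<mu> J"
  shows "(\<lambda>t. 0) \<in> J 0"
proof -
  obtain f where "f \<in> J 0" using dual_L1_isometry_ex_rep[OF J] by blast
  then show ?thesis using dual_L1_isometry_scale[OF J, of f 0 0] by simp
qed

lemma dual_L1_isometry_sum:
  assumes J: "dual_L1_isometry \<mu> J" and "\<And>i. i \<in> K \<Longrightarrow> f i \<in> J (\<phi> i)"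
  shows "(\<lambda>t. \<Sum>i\<in>K. f i t) \<in> J (\<Sum>i\<in>K. \<phi> i)"
  using assms(2)
  by (induction K rule: infinite_finite_induct)
    (auto intro: dual_L1_isometry_zero[OF J] dual_L1_isometry_add[OF J])

text \<open>The norm of \<open>\<phi> - \<psi>\<close> is the integral of
  \<open>\<bar>f t - g t\<bar>\<close>, which is 0. Identities that hold almost everywhere thereby
  become identities of functionals.\<close>

lemma dual_L1_isometry_eqI:
  assumes J: "dual_L1_isometry \<mu> J" and f: "f \<in> J \<phi>" and g: "g \<in> J \<psi>"
    and eq: "AE t in \<mu>. f t = g t"
  shows "\<phi> = \<psi>"
proof -
  have d: "(\<lambda>t. f t + (-1) * g t) \<in> J (\<phi> + (-1) *\<^sub>R \<psi>)"
    by (intro dual_L1_isometry_add[OF J] dual_L1_isometry_scale[OF J] f g)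
  have "norm (\<phi> + (-1) *\<^sub>R \<psi>) = (LINT t|\<mu>. \<bar>f t + (-1) * g t\<bar>)"
    using dual_L1_isometry_norm[OF J d] by simp
  also have "\<dots> = (LINT t|\<mu>. 0)"
    using eq dual_L1_isometry_integrable[OF J f] dual_L1_isometry_integrable[OF J g]
    by (intro integral_cong_AE) auto
  finally show ?thesis by simp
qed

lemma dual_L1_isometry_zeroD:
  assumes J: "dual_L1_isometry \<mu> J" and f: "f \<in> J 0"
  shows "AE t in \<mu>. f t = 0"
proof -
  have "(LINT t|\<mu>. \<bar>f t\<bar>) = 0"
    using dual_L1_isometry_norm[OF J f] by simp
  moreover have "integrable \<mu> (\<lambda>t. \<bar>f t\<bar>)"
    using dual_L1_isometry_integrable[OF J f] by simp
  ultimately have "AE t in \<mu>. \<bar>f t\<bar> = 0"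
    using integral_nonneg_eq_0_iff_AE[of \<mu> "\<lambda>t. \<bar>f t\<bar>"] by simp
  then show ?thesis by simp
qed

section \<open>Antisymmetric transport of balanced real tuples\<close>

text \<open>
  The amount that index \<open>i\<close> sends to index \<open>j\<close> when the positive parts of \<open>a\<close> are transported
  proportionally to the negative parts. If all \<open>a k\<close> vanish, division by zero gives the
  desired value \<open>0\<close>.
\<close>

definition transport :: "'i set \<Rightarrow> ('i \<Rightarrow> real) \<Rightarrow> 'i \<Rightarrow> 'i \<Rightarrow> real"
  where "transport K a i j =
    (max 0 (a i) * max 0 (- a j) - max 0 (a j) * max 0 (- a i)) / (\<Sum>k\<in>K. max 0 (a k))"

lemma transport_antisym: "transport K a i j = - transport K a j i"
  by (simp add: transport_def minus_divide_left)

context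
  fixes K :: "'i set" and a :: "'i \<Rightarrow> real"
  assumes fin: "finite K" and bal: "(\<Sum>k\<in>K. a k) = 0"
begin

lemma sum_neg_part: "(\<Sum>k\<in>K. max 0 (- a k)) = (\<Sum>k\<in>K. max 0 (a k))"
proof -
  have "(\<Sum>k\<in>K. max 0 (a k)) - (\<Sum>k\<in>K. max 0 (- a k)) = (\<Sum>k\<in>K. a k)"
    by (subst sum_subtractf[symmetric]) (auto intro!: sum.cong)
  then show ?thesis using bal by simp
qed

text \<open>By balance the positive and the negative parts have the same total. Summation over
  \<open>j\<close> produces this total in both products, where it cancels against the denominator;
  if it is 0, so is \<open>a i\<close>.\<close>

lemma sum_transport:
  assumes i: "i \<in> K"
  shows "(\<Sum>j\<in>K. transport K a i j) = a i"
proof -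
  let ?P = "\<Sum>k\<in>K. max 0 (a k)"
  have "(\<Sum>j\<in>K. transport K a i j) = (max 0 (a i) * ?P - max 0 (- a i) * ?P) / ?P"
    unfolding transport_def
    by (simp add: sum_neg_part sum_subtractf flip: sum_divide_distrib sum_distrib_left sum_distrib_right)
  also have "\<dots> = a i"
  proof (cases "?P = 0")
    case True
    have "max 0 (a i) = 0"
      using True i fin by (subst (asm) sum_nonneg_eq_0_iff) auto
    moreover have "max 0 (- a i) = 0"
      using True i fin unfolding sum_neg_part[symmetric]
      by (subst (asm) sum_nonneg_eq_0_iff) auto
    ultimately show ?thesis using True by simp
  next
    case False
    then show ?thesis by (simp add: max_def flip: left_diff_distrib)
  qed
  finally show ?thesis .
qed

text \<open>With the minus sign in the numerators replaced by plus, they add up to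
  \<open>2 * ?P * ?P\<close>, and \<open>2 * ?P\<close> is the sum of all
  \<open>\<bar>a i\<bar>\<close>. Hence the transport costs no norm.\<close>

lemma sum_abs_transport_le: "(\<Sum>i\<in>K. \<Sum>j\<in>K. \<bar>transport K a i j\<bar>) \<le> (\<Sum>i\<in>K. \<bar>a i\<bar>)"
proof -
  let ?P = "\<Sum>k\<in>K. max 0 (a k)"
  have P: "?P \<ge> 0" by (rule sum_nonneg) simp
  have "(\<Sum>i\<in>K. \<Sum>j\<in>K. \<bar>transport K a i j\<bar>)
      \<le> (\<Sum>i\<in>K. \<Sum>j\<in>K. (max 0 (a i) * max 0 (- a j) + max 0 (a j) * max 0 (- a i)) / ?P)"
  proof (intro sum_mono)
    fix i j
    have "\<bar>x - y\<bar> \<le> x + y" if "x \<ge> 0" "y \<ge> 0" for x y :: real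
      using that by simp
    then show "\<bar>transport K a i j\<bar>
        \<le> (max 0 (a i) * max 0 (- a j) + max 0 (a j) * max 0 (- a i)) / ?P"
      unfolding transport_def using P by (simp add: abs_divide divide_right_mono)
  qed
  also have "\<dots> = (?P * ?P + ?P * ?P) / ?P"
    by (simp add: sum_neg_part sum.distrib
        flip: sum_divide_distrib sum_distrib_left sum_distrib_right)
  also have "\<dots> = ?P + ?P"
    by (cases "?P = 0") (simp_all add: field_simps)
  also have "\<dots> = (\<Sum>i\<in>K. \<bar>a i\<bar>)"
    by (subst (2) sum_neg_part[symmetric]) (auto simp flip: sum.distrib intro!: sum.cong)
  finally show ?thesis .
qed

end

text \<open>Each positive part is at most the denominator, so the quotient is dominated by
  \<open>\<bar>f j t\<bar> + \<bar>f i t\<bar>\<close>.\<close>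

lemma integrable_transport:
  assumes fin: "finite K" and f: "\<And>k. k \<in> K \<Longrightarrow> integrable \<mu> (f k)"
    and i: "i \<in> K" and j: "j \<in> K"
  shows "integrable \<mu> (\<lambda>t. transport K (\<lambda>k. f k t) i j)"
proof (rule Bochner_Integration.integrable_bound)
  show "integrable \<mu> (\<lambda>t. \<bar>f j t\<bar> + \<bar>f i t\<bar>)"
    using f i j by simp
  have meas: "f k \<in> borel_measurable \<mu>" if "k \<in> K" for k
    using f[OF that] by (rule borel_measurable_integrable)
  have "(\<lambda>t. \<Sum>k\<in>K. max 0 (f k t)) \<in> borel_measurable \<mu>"
    using meas by (intro borel_measurable_sum borel_measurable_max) auto
  then show "(\<lambda>t. transport K (\<lambda>k. f k t) i j) \<in> borel_measurable \<mu>"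
    unfolding transport_def using meas[OF i] meas[OF j] by measurable
  have "\<bar>transport K a i j\<bar> \<le> \<bar>a j\<bar> + \<bar>a i\<bar>" for a
  proof -
    let ?P = "\<Sum>k\<in>K. max 0 (a k)"
    have P: "max 0 (a k) \<le> ?P" if "k \<in> K" for k
      using fin that by (intro member_le_sum) auto
    show ?thesis
    proof (cases "?P = 0")
      case False
      then have pos: "?P > 0"
        using sum_nonneg[of K "\<lambda>k. max 0 (a k)"] by simp
      have b: "max 0 (a i) * max 0 (- a j) \<le> ?P * \<bar>a j\<bar>"
        "max 0 (a j) * max 0 (- a i) \<le> ?P * \<bar>a i\<bar>"
        using P[OF i] P[OF j] pos by (auto intro!: mult_mono)
      have "\<bar>x - y\<bar> \<le> x + y" if "x \<ge> 0" "y \<ge> 0" for x y :: real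
        using that by simp
      then have "\<bar>max 0 (a i) * max 0 (- a j) - max 0 (a j) * max 0 (- a i)\<bar>
          \<le> max 0 (a i) * max 0 (- a j) + max 0 (a j) * max 0 (- a i)"
        by simp
      also have "\<dots> \<le> (\<bar>a j\<bar> + \<bar>a i\<bar>) * ?P"
        using b by (simp add: algebra_simps)
      finally show ?thesis
        unfolding transport_def using pos by (simp add: abs_divide pos_divide_le_eq)
    qed (simp add: transport_def)
  qed
  then show "AE t in \<mu>. norm (transport K (\<lambda>k. f k t) i j) \<le> norm (\<bar>f j t\<bar> + \<bar>f i t\<bar>)"
    by (auto intro!: AE_I2)
qed

text \<open>Each \<open>\<psi> i j\<close> is represented by the pointwise transport between
  representatives of the \<open>\<phi> k\<close>. These are balanced almost everywhere, so the row
  sums carry over to functionals, and the pointwise bound carries over to norms by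
  integration.\<close>

lemma lindenstrauss_dual_decomposition:
  fixes \<phi> :: "'i \<Rightarrow> ('y::banach \<Rightarrow>\<^sub>L real)"
  assumes L: "lindenstrauss_space TYPE('y) TYPE('b)"
    and fin: "finite K" and sum0: "(\<Sum>k\<in>K. \<phi> k) = 0"
  obtains \<psi> where "\<And>i j. i \<in> K \<Longrightarrow> j \<in> K \<Longrightarrow> \<psi> i j = - \<psi> j i"
    and "\<And>i. i \<in> K \<Longrightarrow> (\<Sum>j\<in>K. \<psi> i j) = \<phi> i"
    and "(\<Sum>i\<in>K. \<Sum>j\<in>K. norm (\<psi> i j)) \<le> (\<Sum>k\<in>K. norm (\<phi> k))"
proof -
  obtain \<mu> :: "'b measure" and J :: "('y \<Rightarrow>\<^sub>L real) \<Rightarrow> ('b \<Rightarrow> real) set"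
    where J: "dual_L1_isometry \<mu> J"
    using L unfolding lindenstrauss_space_def by blast
  have "\<exists>f. \<forall>k. integrable \<mu> (f k) \<and> f k \<in> J (\<phi> k)"
    using dual_L1_isometry_ex_rep[OF J] by (intro choice allI) blast
  then obtain f where int: "\<And>k. integrable \<mu> (f k)" and f: "\<And>k. f k \<in> J (\<phi> k)"
    by blast
  define h where "h i j t = transport K (\<lambda>k. f k t) i j" for i j t
  have inth: "integrable \<mu> (h i j)" if "i \<in> K" "j \<in> K" for i j
    unfolding h_def using integrable_transport[OF fin int that] .
  have "\<exists>\<psi>. i \<in> K \<and> j \<in> K \<longrightarrow> h i j \<in> J \<psi>" for i j
    using dual_L1_isometry_ex_functional[OF J inth] by blast
  then obtain \<psi> where \<psi>: "\<And>i j. i \<in> K \<Longrightarrow> j \<in> K \<Longrightarrow> h i j \<in> J (\<psi> i j)"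
    by metis
  have bal: "AE t in \<mu>. (\<Sum>k\<in>K. f k t) = 0"
    proof (rule dual_L1_isometry_zeroD[OF J])
    show "(\<lambda>t. \<Sum>k\<in>K. f k t) \<in> J 0"
      using dual_L1_isometry_sum[OF J, where K = K and f = f and \<phi> = \<phi>, OF f] sum0 by simp
  qed
  show thesis
  proof (rule that)
    fix i j assume ij: "i \<in> K" "j \<in> K"
    have "(\<lambda>t. (-1) * h j i t) = h i j"
      unfolding h_def by (subst transport_antisym) simp
    then have "h i j \<in> J ((-1) *\<^sub>R \<psi> j i)"
      using dual_L1_isometry_scale[OF J \<psi>[OF ij(2,1)], of "-1"] by simp
    from dual_L1_isometry_eqI[OF J \<psi>[OF ij] this] show "\<psi> i j = - \<psi> j i"
      by simp
  next
    fix i assume i: "i \<in> K"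
    have "AE t in \<mu>. (\<Sum>j\<in>K. h i j t) = f i t"
      using bal by eventually_elim (simp add: h_def sum_transport fin i)
    then show "(\<Sum>j\<in>K. \<psi> i j) = \<phi> i"
      using \<psi>[OF i] f by (intro dual_L1_isometry_eqI[OF J dual_L1_isometry_sum[OF J]])
  next
    have "(\<Sum>i\<in>K. \<Sum>j\<in>K. norm (\<psi> i j)) = (\<Sum>i\<in>K. \<Sum>j\<in>K. (LINT t|\<mu>. \<bar>h i j t\<bar>))"
      using dual_L1_isometry_norm[OF J \<psi>] by (intro sum.cong) auto
    also have "\<dots> = (LINT t|\<mu>. (\<Sum>i\<in>K. \<Sum>j\<in>K. \<bar>h i j t\<bar>))"
      using inth by (simp add: Bochner_Integration.integral_sum)
    also have "\<dots> \<le> (LINT t|\<mu>. (\<Sum>k\<in>K. \<bar>f k t\<bar>))"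
    proof (rule integral_mono_AE)
      show "AE t in \<mu>. (\<Sum>i\<in>K. \<Sum>j\<in>K. \<bar>h i j t\<bar>) \<le> (\<Sum>k\<in>K. \<bar>f k t\<bar>)"
        using bal by eventually_elim (simp add: h_def sum_abs_transport_le fin)
    qed (use inth int in auto)
    also have "\<dots> = (\<Sum>k\<in>K. norm (\<phi> k))"
      using int dual_L1_isometry_norm[OF J f] by (simp add: Bochner_Integration.integral_sum)
    finally show "(\<Sum>i\<in>K. \<Sum>j\<in>K. norm (\<psi> i j)) \<le> (\<Sum>k\<in>K. norm (\<phi> k))" .
  qed
qed

section \<open>Almost centers in Lindenstrauss spaces\<close>

text \<open>If \<open>norm \<phi> - e\<close> is positive, it fails as an operator bound at some
  \<open>v\<close>, which is then normalized and given the right sign. Otherwise \<open>0\<close>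
  will do.\<close>

lemma blinfun_almost_attains_norm:
  fixes \<phi> :: "'y::real_normed_vector \<Rightarrow>\<^sub>L real"
  assumes "e > 0"
  obtains v where "norm v \<le> 1" "norm \<phi> - e \<le> \<phi> v"
proof (cases "norm \<phi> - e \<le> 0")
  case True
  then show thesis using that[of 0] by simp
next
  case False
  have "\<exists>v. \<not> norm (\<phi> v) \<le> (norm \<phi> - e) * norm v"
    using norm_blinfun_bound[of "norm \<phi> - e" \<phi>] False assms by auto
  then obtain v where v: "\<bar>\<phi> v\<bar> > (norm \<phi> - e) * norm v"
    by (auto simp: not_le)
  then have "norm v > 0" by auto
  define w where "w = (sgn (\<phi> v) / norm v) *\<^sub>R v"
  have "\<phi> w = \<bar>\<phi> v\<bar> / norm v"
    by (simp add: w_def blinfun.scaleR_right abs_sgn)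
  then have "norm \<phi> - e \<le> \<phi> w"
    using v \<open>norm v > 0\<close> by (simp add: pos_le_divide_eq)
  moreover have "norm w \<le> 1"
    using \<open>norm v > 0\<close> by (simp add: w_def sgn_real_def)
  ultimately show thesis by (intro that)
qed

text \<open>For finite \<open>K\<close> this embeds the power \<open>Y^K\<close> with the maximum
  norm into a normed type, as the functions that vanish off \<open>K\<close>.\<close>

definition restricted :: "'w set \<Rightarrow> ('w \<Rightarrow> 'y::real_normed_vector) \<Rightarrow> ('w, 'y) bfun"
  where "restricted K u = Bfun (\<lambda>x. if x \<in> K then u x else 0)"

lemma apply_restricted:
  assumes "finite K"
  shows "apply_bfun (restricted K u) x = (if x \<in> K then u x else 0)"
proof -
  have "finite (range (\<lambda>x. if x \<in> K then u x else 0))"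
    by (rule finite_subset[of _ "insert 0 (u ` K)"]) (use assms in auto)
  then show ?thesis
    unfolding restricted_def by (subst Bfun_inverse) (auto intro: finite_imp_bounded)
qed

text \<open>The sum of norms is dual to the maximum norm: unit-ball vectors that almost norm each
  \<open>\<phi> k\<close> form a tuple in the unit ball, and there \<open>F\<close> almost reaches
  the sum.\<close>

lemma sum_norm_components_le:
  fixes F :: "('w, 'y::real_normed_vector) bfun \<Rightarrow>\<^sub>L real" and \<phi> :: "'w \<Rightarrow> 'y \<Rightarrow>\<^sub>L real"
  assumes fin: "finite K" and \<phi>: "\<And>u. F (restricted K u) = (\<Sum>k\<in>K. \<phi> k (u k))"
  shows "(\<Sum>k\<in>K. norm (\<phi> k)) \<le> norm F"
proof (rule field_le_epsilon)
  fix e :: real assume e: "e > 0"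
  \<comment> \<open>The error \<open>d\<close> occurs once for each of the \<open>card K\<close>
    components; the added 1 covers empty \<open>K\<close>.\<close>
  define d where "d = e / (card K + 1)"
  have d: "d > 0" "card K * d \<le> e"
    using e by (auto simp: d_def field_simps)
  have "\<exists>u. \<forall>k. norm (u k) \<le> 1 \<and> norm (\<phi> k) - d \<le> \<phi> k (u k)"
    by (intro choice allI) (metis blinfun_almost_attains_norm[OF d(1)])
  then obtain u where u: "\<And>k. norm (u k) \<le> 1" "\<And>k. norm (\<phi> k) - d \<le> \<phi> k (u k)"
    by blast
  have "norm (restricted K u) \<le> 1"
    using u(1) by (intro norm_bfun_le) (simp add: apply_restricted fin)
  then have "F (restricted K u) \<le> norm F"
    using norm_blinfun[of F "restricted K u"] mult_left_mono[of "norm (restricted K u)" 1 "norm F"]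
    by simp
  moreover have "(\<Sum>k\<in>K. norm (\<phi> k) - d) \<le> (\<Sum>k\<in>K. \<phi> k (u k))"
    by (intro sum_mono u)
  ultimately show "(\<Sum>k\<in>K. norm (\<phi> k)) \<le> norm F + e"
    using d by (simp add: \<phi> sum_subtractf)
qed

text \<open>
  The distance of the tuple \<open>(k)\<close>, indexed by \<open>k \<in> K\<close>, from the constant tuples in the maximum
  norm is the Chebyshev radius of \<open>K\<close>; a norming functional for it has components \<open>\<phi> k\<close> with
  sum \<open>0\<close>, which the \<open>L\<^sup>1\<close> decomposition turns into a combination of differences \<open>i - j\<close>.
\<close>

lemma lindenstrauss_finite_almost_center:
  fixes K :: "'y::banach set"
  assumes L: "lindenstrauss_space TYPE('y) TYPE('b)"
    and fin: "finite K" and diam: "\<And>i j. i \<in> K \<Longrightarrow> j \<in> K \<Longrightarrow> norm (i - j) \<le> d"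
    and e: "e > 0"
  obtains c where "\<And>k. k \<in> K \<Longrightarrow> norm (k - c) \<le> d / 2 + e"
proof (cases "K = {}")
  case True
  then show thesis using that by blast
next
  case False
  then obtain k0 where "k0 \<in> K" by blast
  then have "d \<ge> 0" using diam[of k0 k0] by simp
  define W :: "('y, 'y) bfun set" where "W = range (\<lambda>y. restricted K (\<lambda>_. y))"
  let ?z = "restricted K (\<lambda>k. k)"
  have ap: "apply_bfun (restricted K u) x = (if x \<in> K then u x else 0)" for u :: "'y \<Rightarrow> 'y" and x
    by (rule apply_restricted[OF fin])
  have add: "restricted K (\<lambda>k. u k + v k) = restricted K u + restricted K v" for u v :: "'y \<Rightarrow> 'y"
    by (rule bfun_eqI) (simp add: ap)
  have scale: "restricted K (\<lambda>k. a *\<^sub>R u k) = a *\<^sub>R restricted K u" for a and u :: "'y \<Rightarrow> 'y"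
    by (rule bfun_eqI) (simp add: ap)
  have "subspace W"
  proof (rule subspaceI)
    have "restricted K (\<lambda>_. 0 :: 'y) = 0" by (rule bfun_eqI) (simp add: ap)
    then show "0 \<in> W" unfolding W_def by (metis rangeI)
  next
    fix x y assume "x \<in> W" "y \<in> W"
    then show "x + y \<in> W" unfolding W_def by (auto simp flip: add)
  next
    fix a x assume "x \<in> W"
    then show "a *\<^sub>R x \<in> W" unfolding W_def by (auto simp flip: scale)
  qed
  then obtain F :: "('y, 'y) bfun \<Rightarrow>\<^sub>L real" where F: "norm F \<le> 1" "\<And>w. w \<in> W \<Longrightarrow> F w = 0"
    "F ?z = infdist ?z W"
    using Hahn_Banach_subspace_distance by blast
  define \<phi> where "\<phi> k = Blinfun (\<lambda>v. F (restricted K (\<lambda>i. if i = k then v else 0)))" for k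
  have ap\<phi>: "\<phi> k v = F (restricted K (\<lambda>i. if i = k then v else 0))" for k v
    unfolding \<phi>_def
  proof (subst bounded_linear_Blinfun_apply)
    have "bounded_linear (\<lambda>v :: 'y. restricted K (\<lambda>i. if i = k then v else 0))"
    proof (rule bounded_linear_intro[where K = 1])
      fix v :: 'y
      show "norm (restricted K (\<lambda>i. if i = k then v else 0)) \<le> norm v * 1"
        by (rule norm_bfun_le) (simp add: ap)
    qed (auto intro!: bfun_eqI simp: ap)
    then show "bounded_linear (\<lambda>v. F (restricted K (\<lambda>i. if i = k then v else 0)))"
      by (rule bounded_linear_compose[OF blinfun.bounded_linear_right])
  qed simp
  have decomp: "F (restricted K u) = (\<Sum>k\<in>K. \<phi> k (u k))" for u
  proof -
    have sum_apply: "apply_bfun (sum g A) x = (\<Sum>k\<in>A. apply_bfun (g k) x)"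
      for g :: "'y \<Rightarrow> ('y, 'y) bfun" and A x
      by (induction A rule: infinite_finite_induct) auto
    have "restricted K u = (\<Sum>k\<in>K. restricted K (\<lambda>i. if i = k then u k else 0))"
    proof (rule bfun_eqI)
      fix x
      show "apply_bfun (restricted K u) x
          = apply_bfun (\<Sum>k\<in>K. restricted K (\<lambda>i. if i = k then u k else 0)) x"
        using fin by (simp add: sum_apply ap)
    qed
    then show ?thesis by (simp add: blinfun.sum_right ap\<phi>)
  qed
  have "(\<Sum>k\<in>K. \<phi> k) = 0"
  proof (rule blinfun_eqI)
    fix v
    have "(\<Sum>k\<in>K. \<phi> k v) = F (restricted K (\<lambda>_. v))" by (simp add: decomp)
    also have "\<dots> = 0" by (rule F) (simp add: W_def)
    finally show "blinfun_apply (\<Sum>k\<in>K. \<phi> k) v = blinfun_apply 0 v"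
      by (simp add: blinfun.sum_left)
  qed
  then obtain \<psi> where anti: "\<And>i j. i \<in> K \<Longrightarrow> j \<in> K \<Longrightarrow> \<psi> i j = - \<psi> j i"
    and row: "\<And>i. i \<in> K \<Longrightarrow> (\<Sum>j\<in>K. \<psi> i j) = \<phi> i"
    and total: "(\<Sum>i\<in>K. \<Sum>j\<in>K. norm (\<psi> i j)) \<le> (\<Sum>k\<in>K. norm (\<phi> k))"
    using lindenstrauss_dual_decomposition[OF L fin] by blast
  have z: "infdist ?z W = (\<Sum>i\<in>K. \<Sum>j\<in>K. \<psi> i j i)"
    using F(3) by (simp add: decomp blinfun.sum_left flip: row)
  \<comment> \<open>Swapping the indices and using antisymmetry gives a second expression, with
    \<open>- j\<close> in place of \<open>i\<close>. Adding the two produces the differences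
    \<open>i - j\<close>.\<close>
  have z': "infdist ?z W = (\<Sum>i\<in>K. \<Sum>j\<in>K. - \<psi> i j j)"
  proof -
    have "infdist ?z W = (\<Sum>j\<in>K. \<Sum>i\<in>K. \<psi> i j i)"
      unfolding z by (rule sum.swap)
    also have "\<dots> = (\<Sum>j\<in>K. \<Sum>i\<in>K. - \<psi> j i i)"
    proof (intro sum.cong refl)
      fix i j assume "j \<in> K" "i \<in> K"
      then show "\<psi> i j i = - \<psi> j i i"
        using anti[of i j] by (simp add: blinfun.minus_left)
    qed
    finally show ?thesis .
  qed
  have "2 * infdist ?z W = (\<Sum>i\<in>K. \<Sum>j\<in>K. \<psi> i j i) + (\<Sum>i\<in>K. \<Sum>j\<in>K. - \<psi> i j j)"
    using z z' by simp
  also have "\<dots> = (\<Sum>i\<in>K. \<Sum>j\<in>K. \<psi> i j (i - j))"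
    by (simp add: blinfun.diff_right sum_subtractf sum_negf)
  also have "\<dots> \<le> (\<Sum>i\<in>K. \<Sum>j\<in>K. norm (\<psi> i j) * d)"
  proof (intro sum_mono)
    fix i j assume "i \<in> K" "j \<in> K"
    then show "\<psi> i j (i - j) \<le> norm (\<psi> i j) * d"
      using norm_blinfun[of "\<psi> i j" "i - j"] mult_left_mono[OF diam, of i j "norm (\<psi> i j)"]
      by simp
  qed
  also have "\<dots> = (\<Sum>i\<in>K. \<Sum>j\<in>K. norm (\<psi> i j)) * d"
    by (simp add: sum_distrib_right)
  also have "\<dots> \<le> 1 * d"
    using total sum_norm_components_le[OF fin decomp] F(1) \<open>d \<ge> 0\<close>
    by (intro mult_right_mono) auto
  finally have "infdist ?z W \<le> d / 2" by simp
  \<comment> \<open>The distance to \<open>W\<close> is only approximated by an element of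
    \<open>W\<close>, whence the \<open>e\<close>.\<close>
  moreover obtain w where w: "w \<in> W" "dist ?z w < infdist ?z W + e"
    using infdist_approx[of W e ?z] e by (auto simp: W_def)
  ultimately have near: "norm (?z - w) \<le> d / 2 + e"
    by (simp add: dist_norm)
  obtain c where "w = restricted K (\<lambda>_. c)"
    using w(1) by (auto simp: W_def)
  with near have c: "norm (?z - restricted K (\<lambda>_. c)) \<le> d / 2 + e"
    by simp
  show thesis
  proof (rule that)
    fix k assume "k \<in> K"
    then show "norm (k - c) \<le> d / 2 + e"
      using order_trans[OF norm_apply_bfun_le c, of k] by (simp add: ap)
  qed
qed

section \<open>Measures of noncompactness\<close>

lemma kuratowski_le:
  assumes "e > 0" "finite \<C>" "S \<subseteq> \<Union>\<C>" "\<And>C. C \<in> \<C> \<Longrightarrow> bounded C \<and> diameter C \<le> e"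
  shows "kuratowski S \<le> e"
  unfolding kuratowski_def
  by (rule cInf_lower) (use assms in \<open>auto intro!: bdd_belowI[of _ 0]\<close>)

text \<open>Cutting the covering sets down to \<open>S\<close> and dropping the empty set makes it
  possible to pick a point of \<open>S\<close> from every piece.\<close>

lemma kuratowski_cover:
  assumes S: "bounded S" and k: "kuratowski S < e"
  obtains \<C> where "finite \<C>" "\<Union>\<C> = S" "{} \<notin> \<C>"
    "\<And>C x y. C \<in> \<C> \<Longrightarrow> x \<in> C \<Longrightarrow> y \<in> C \<Longrightarrow> dist x y \<le> e"
proof -
  let ?E = "{\<epsilon>. \<epsilon> > 0 \<and> (\<exists>\<C>. finite \<C> \<and> S \<subseteq> \<Union>\<C> \<and> (\<forall>C\<in>\<C>. bounded C \<and> diameter C \<le> \<epsilon>))}"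
  \<comment> \<open>The set \<open>S\<close> covers itself; \<open>max 1\<close> keeps the bound
    positive when the diameter is 0.\<close>
  have "max 1 (diameter S) \<in> ?E"
    using S by (intro CollectI conjI exI[of _ "{S}"]) auto
  then have "?E \<noteq> {}" by blast
  moreover have "Inf ?E < e" using k by (simp only: kuratowski_def)
  ultimately obtain d where "d \<in> ?E" "d < e"
    by (rule cInf_lessD[THEN bexE])
  then obtain \<C> where \<C>: "finite \<C>" "S \<subseteq> \<Union>\<C>" "\<And>C. C \<in> \<C> \<Longrightarrow> bounded C \<and> diameter C \<le> d"
    by blast
  show thesis
  proof (rule that[of "(\<lambda>C. C \<inter> S) ` \<C> - {{}}"])
    fix C x y assume "C \<in> (\<lambda>C. C \<inter> S) ` \<C> - {{}}" "x \<in> C" "y \<in> C"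
    then obtain D where "D \<in> \<C>" "x \<in> D" "y \<in> D" by blast
    then show "dist x y \<le> e"
      using diameter_bounded_bound[of D x y] \<C>(3)[of D] \<open>d < e\<close> by simp
  next
    show "\<Union>((\<lambda>C. C \<inter> S) ` \<C> - {{}}) = S"
      using \<C>(2) by blast
  qed (use \<C> in auto)
qed

lemma kuratowski_nonneg: "bounded S \<Longrightarrow> 0 \<le> kuratowski S"
  unfolding kuratowski_def
  by (rule cInf_greatest) (auto intro!: exI[of _ "max 1 (diameter S)"] exI[of _ "{S}"])

lemma bounded_apply_bfun_image:
  assumes "bounded M"
  shows "bounded ((\<lambda>f. apply_bfun f x) ` M)"
proof -
  obtain B where "\<And>f. f \<in> M \<Longrightarrow> norm f \<le> B"
    using assms by (auto simp: bounded_iff)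
  then show ?thesis
    by (intro boundedI[of _ B]) (auto intro: order_trans[OF norm_apply_bfun_le])
qed

text \<open>A real supremum dominates its members only for a family bounded above. Here
  \<open>2 * B\<close> is an upper bound, as all values of members of \<open>M\<close> have norm at
  most \<open>B\<close>.\<close>

lemma pointwise_relatively_compactD:
  fixes M :: "('w, 'y::real_normed_vector) bfun set"
  assumes M: "bounded M" and pc: "pointwise_relatively_compact M"
  shows "kuratowski ((\<lambda>f. apply_bfun f x) ` M) = 0"
proof (rule antisym)
  obtain B where B: "B > 0" "\<And>f. f \<in> M \<Longrightarrow> norm f \<le> B"
    using M unfolding bounded_pos by blast
  have "kuratowski ((\<lambda>f. apply_bfun f x) ` M) \<le> 2 * B" for x
  proof (rule kuratowski_le[of _ "{(\<lambda>f. apply_bfun f x) ` M}"])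
    fix C assume C: "C \<in> {(\<lambda>f. apply_bfun f x) ` M}"
    have "norm (apply_bfun f x - apply_bfun g x) \<le> 2 * B" if "f \<in> M" "g \<in> M" for f g
      using norm_triangle_ineq4[of "apply_bfun f x" "apply_bfun g x"] B(2)[OF that(1)] B(2)[OF that(2)]
        norm_apply_bfun_le[of f x] norm_apply_bfun_le[of g x] by linarith
    then have "diameter C \<le> 2 * B"
      using C B(1) by (intro diameter_le) auto
    then show "bounded C \<and> diameter C \<le> 2 * B"
      using bounded_apply_bfun_image[OF M] C by blast
  qed (use B in auto)
  then have "bdd_above (range (\<lambda>x. kuratowski ((\<lambda>f. apply_bfun f x) ` M)))"
    by (intro bdd_aboveI2)
  from cSUP_upper[OF UNIV_I this, of x] pc
  show "kuratowski ((\<lambda>f. apply_bfun f x) ` M) \<le> 0"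
    by (simp add: pointwise_relatively_compact_def)
qed (rule kuratowski_nonneg[OF bounded_apply_bfun_image[OF M]])

section \<open>Almost centers of relatively compact sets\<close>

text \<open>One point from each of finitely many pieces of diameter at most \<open>e / 2\<close>
  forms a finite net. An almost center of the net with error \<open>e / 2\<close> is one of
  \<open>S\<close> with error \<open>e\<close>.\<close>

lemma lindenstrauss_almost_center:
  fixes S :: "'y::banach set"
  assumes L: "lindenstrauss_space TYPE('y) TYPE('b)"
    and diam: "\<And>x y. x \<in> S \<Longrightarrow> y \<in> S \<Longrightarrow> norm (x - y) \<le> d"
    and S: "bounded S" "kuratowski S = 0" and e: "e > 0"
  obtains c where "\<And>x. x \<in> S \<Longrightarrow> norm (x - c) \<le> d / 2 + e"
proof -
  obtain \<C> where \<C>: "finite \<C>" "\<Union>\<C> = S" "{} \<notin> \<C>"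
    "\<And>C x y. C \<in> \<C> \<Longrightarrow> x \<in> C \<Longrightarrow> y \<in> C \<Longrightarrow> dist x y \<le> e / 2"
    by (rule kuratowski_cover[OF S(1), of "e / 2"]) (use S(2) e in simp, blast)
  have "\<forall>C\<in>\<C>. \<exists>x. x \<in> C" using \<C>(3) by (metis ex_in_conv)
  then obtain p where p: "\<And>C. C \<in> \<C> \<Longrightarrow> p C \<in> C" by metis
  have inS: "p C \<in> S" if "C \<in> \<C>" for C using p[OF that] \<C>(2) that by blast
  have fin: "finite (p ` \<C>)" using \<C>(1) by simp
  have dp: "norm (i - j) \<le> d" if "i \<in> p ` \<C>" "j \<in> p ` \<C>" for i j
    using that inS diam by blast
  obtain c where c: "\<And>k. k \<in> p ` \<C> \<Longrightarrow> norm (k - c) \<le> d / 2 + e / 2"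
    using lindenstrauss_finite_almost_center[OF L fin dp half_gt_zero[OF e]] by metis
  show thesis
  proof (rule that)
    fix x assume "x \<in> S"
    then obtain C where C: "C \<in> \<C>" "x \<in> C" using \<C>(2) by blast
    have "norm (x - p C) \<le> e / 2"
      using \<C>(4)[OF C p[OF C(1)]] by (simp add: dist_norm)
    moreover have "norm (p C - c) \<le> d / 2 + e / 2" using c C(1) by blast
    ultimately show "norm (x - c) \<le> d / 2 + e"
      using norm_triangle_ineq[of "x - p C" "p C - c"] by simp
  qed
qed

lemma kuratowski_mono:
  assumes "bounded T" "S \<subseteq> T"
  shows "kuratowski S \<le> kuratowski T"
proof (rule dense_ge)
  fix e assume e: "kuratowski T < e"
  obtain \<C> where \<C>: "finite \<C>" "\<Union>\<C> = T"
    "\<And>C x y. C \<in> \<C> \<Longrightarrow> x \<in> C \<Longrightarrow> y \<in> C \<Longrightarrow> dist x y \<le> e"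
    using kuratowski_cover[OF assms(1) e] by metis
  have "e > 0" using kuratowski_nonneg[OF assms(1)] e by simp
  show "kuratowski S \<le> e"
  proof (rule kuratowski_le[OF \<open>e > 0\<close> \<C>(1)])
    fix C assume C: "C \<in> \<C>"
    have "diameter C \<le> e"
      unfolding diameter_def using \<C>(3)[OF C] \<open>e > 0\<close> by (auto intro!: cSUP_least)
    moreover have "bounded C"
      using C \<C>(2) assms(1) bounded_subset by blast
    ultimately show "bounded C \<and> diameter C \<le> e" by simp
  qed (use assms \<C> in simp)
qed

text \<open>A center is chosen at each point independently. One member \<open>g\<close> of
  \<open>C\<close> keeps them all within \<open>norm g + (d / 2 + e)\<close>, so that they form a
  bounded function.\<close>

lemma lindenstrauss_almost_center_bfun:
  fixes C :: "('w, 'y::banach) bfun set"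
  assumes L: "lindenstrauss_space TYPE('y) TYPE('b)"
    and diam: "\<And>f g. f \<in> C \<Longrightarrow> g \<in> C \<Longrightarrow> dist f g \<le> d"
    and C: "bounded C" "C \<noteq> {}" "\<And>x. kuratowski ((\<lambda>f. apply_bfun f x) ` C) = 0"
    and e: "e > 0"
  obtains \<phi> where "\<And>f. f \<in> C \<Longrightarrow> norm (f - \<phi>) \<le> d / 2 + e"
proof -
  have "\<exists>c. \<forall>f\<in>C. norm (apply_bfun f x - c) \<le> d / 2 + e" for x
  proof -
    have dx: "norm (apply_bfun f x - apply_bfun g x) \<le> d" if "f \<in> C" "g \<in> C" for f g
      using norm_apply_bfun_le[of "f - g" x] diam[OF that] by (simp add: dist_norm)
    show ?thesis
      by (rule lindenstrauss_almost_center[OF L, of "(\<lambda>f. apply_bfun f x) ` C" d e])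
        (use dx bounded_apply_bfun_image[OF C(1)] C(3) e in auto)
  qed
  then obtain c where c: "\<And>x f. f \<in> C \<Longrightarrow> norm (apply_bfun f x - c x) \<le> d / 2 + e"
    by metis
  obtain g where g: "g \<in> C" using C(2) by blast
  have "norm (c x) \<le> norm g + (d / 2 + e)" for x
    using c[OF g, of x] norm_apply_bfun_le[of g x] norm_triangle_ineq2[of "c x" "apply_bfun g x"]
    by (simp add: norm_minus_commute)
  then have "bounded (range c)" by (intro boundedI) auto
  then have "apply_bfun (Bfun c) = c" by (intro Bfun_inverse) simp
  then show thesis
    using c by (intro that[of "Bfun c"] norm_bfun_le) simp
qed

section \<open>The two inequalities\<close>

text \<open>On the partition with the single part \<Omega>, a function of norm at most
  \<open>e / 2\<close> has oscillation at most \<open>e\<close>.\<close>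

lemma omega_B_le:
  fixes M :: "('w, 'y::real_normed_vector) bfun set"
  assumes e: "e > 0" and fin: "finite \<Phi>" and M: "\<And>f. f \<in> M \<Longrightarrow> \<exists>\<phi>\<in>\<Phi>. norm (f - \<phi>) \<le> e / 2"
  shows "omega_B M \<le> e"
  unfolding omega_B_def
proof (rule cInf_lower)
  have "diameter (apply_bfun (f - \<phi>) ` UNIV) \<le> e" if "norm (f - \<phi>) \<le> e / 2"
    for f \<phi> :: "('w, 'y) bfun"
  proof (rule diameter_le)
    fix u v assume "u \<in> range (apply_bfun (f - \<phi>))" "v \<in> range (apply_bfun (f - \<phi>))"
    then have "norm u \<le> e / 2" "norm v \<le> e / 2"
      using order_trans[OF norm_apply_bfun_le that] by blast+
    then show "norm (u - v) \<le> e"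
      using norm_triangle_ineq4[of u v] by simp
  qed (use e in simp)
  moreover have "partition_on UNIV {UNIV :: 'w set}"
    by (auto simp: partition_on_def)
  ultimately show "e \<in> {\<epsilon>. \<epsilon> > 0 \<and>
    (\<exists>\<A> \<Phi>. finite \<A> \<and> partition_on (UNIV :: 'w set) \<A> \<and> finite (\<Phi> :: ('w, 'y) bfun set) \<and>
      (\<forall>f\<in>M. \<exists>\<phi>\<in>\<Phi>. \<forall>A\<in>\<A>. diameter (apply_bfun (f - \<phi>) ` A) \<le> \<epsilon>))}"
    using e fin M by (intro CollectI conjI exI[of _ "{UNIV}"] exI[of _ \<Phi>]) (blast | simp)+
qed (auto intro!: bdd_belowI[of _ 0])

lemma lindenstrauss_omega_B_le_kuratowski:
  fixes M :: "('w, 'y::banach) bfun set"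
  assumes L: "lindenstrauss_space TYPE('y) TYPE('b)"
    and M: "bounded M" and pc: "pointwise_relatively_compact M"
  shows "omega_B M \<le> kuratowski M"
proof (rule dense_ge)
  fix e assume e: "kuratowski M < e"
  \<comment> \<open>The gap between \<open>d\<close> and \<open>e\<close> pays for the error of the
    centers: \<open>d / 2 + (e - d) / 2 = e / 2\<close>.\<close>
  then obtain d where d: "kuratowski M < d" "d < e" using dense by blast
  have "d > 0" using kuratowski_nonneg[OF M] d by simp
  obtain \<C> where \<C>: "finite \<C>" "\<Union>\<C> = M" "{} \<notin> \<C>"
    "\<And>C x y. C \<in> \<C> \<Longrightarrow> x \<in> C \<Longrightarrow> y \<in> C \<Longrightarrow> dist x y \<le> d"
    using kuratowski_cover[OF M d(1)] by metis
  have "\<exists>\<phi>. \<forall>f\<in>C. norm (f - \<phi>) \<le> e / 2" if C: "C \<in> \<C>" for C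
  proof -
    have CM: "C \<subseteq> M" using C \<C>(2) by blast
    have k: "kuratowski ((\<lambda>f. apply_bfun f x) ` C) = 0" for x
    proof (rule antisym)
      have "kuratowski ((\<lambda>f. apply_bfun f x) ` C) \<le> kuratowski ((\<lambda>f. apply_bfun f x) ` M)"
        using CM by (intro kuratowski_mono bounded_apply_bfun_image[OF M] image_mono)
      then show "kuratowski ((\<lambda>f. apply_bfun f x) ` C) \<le> 0"
        using pointwise_relatively_compactD[OF M pc] by simp
    qed (intro kuratowski_nonneg bounded_apply_bfun_image bounded_subset[OF M CM])
    have ne: "C \<noteq> {}" using C \<C>(3) by blast
    have "(e - d) / 2 > 0" using d by simp
    then obtain \<phi> where "\<And>f. f \<in> C \<Longrightarrow> norm (f - \<phi>) \<le> d / 2 + (e - d) / 2"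
      using lindenstrauss_almost_center_bfun[OF L \<C>(4)[OF C] bounded_subset[OF M CM] ne k] by metis
    moreover have "d / 2 + (e - d) / 2 = e / 2" by (simp add: field_simps)
    ultimately show ?thesis by auto
  qed
  then obtain \<phi> where \<phi>: "\<And>C f. C \<in> \<C> \<Longrightarrow> f \<in> C \<Longrightarrow> norm (f - \<phi> C) \<le> e / 2"
    by metis
  show "omega_B M \<le> e"
  proof (rule omega_B_le)
    show "\<exists>\<phi>'\<in>\<phi> ` \<C>. norm (f - \<phi>') \<le> e / 2" if "f \<in> M" for f
      using that \<phi> \<C>(2) by blast
  qed (use \<open>d > 0\<close> d \<C>(1) in auto)
qed

lemma kuratowski_le_partition:
  fixes M :: "('w, 'y::real_normed_vector) bfun set"
  assumes M: "bounded M" and pc: "pointwise_relatively_compact M"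
    and fin: "finite \<A>" "finite \<Phi>" and part: "partition_on UNIV \<A>"
    and osc: "\<And>f. f \<in> M \<Longrightarrow> \<exists>\<phi>\<in>\<Phi>. \<forall>A\<in>\<A>. diameter (apply_bfun (f - \<phi>) ` A) \<le> e"
    and e: "e > 0"
  shows "kuratowski M \<le> 2 * e"
proof (rule field_le_epsilon)
  fix d :: real assume d: "d > 0"
  define p where "p A = (SOME x. x \<in> A)" for A :: "'w set"
  have p: "p A \<in> A" if "A \<in> \<A>" for A
    using partition_onD3[OF part] that unfolding p_def by (metis some_in_eq)
  have "\<exists>\<D>. finite \<D> \<and> \<Union>\<D> = (\<lambda>f. apply_bfun f (p A)) ` M
      \<and> (\<forall>D\<in>\<D>. \<forall>x\<in>D. \<forall>y\<in>D. dist x y \<le> d)" for A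
    using kuratowski_cover[OF bounded_apply_bfun_image[OF M]]
      pointwise_relatively_compactD[OF M pc] d by metis
  then obtain \<D> where fin\<D>: "\<And>A. finite (\<D> A)"
    and cov: "\<And>A. \<Union>(\<D> A) = (\<lambda>f. apply_bfun f (p A)) ` M"
    and small: "\<And>A D x y. D \<in> \<D> A \<Longrightarrow> x \<in> D \<Longrightarrow> y \<in> D \<Longrightarrow> dist x y \<le> d"
    by metis
  \<comment> \<open>A cell fixes the approximant \<open>\<phi>\<close> and, for each part
    \<open>A\<close>, a small piece containing the value at the base point \<open>p A\<close>. Only
    finitely many such choices exist.\<close>
  define cell where "cell = (\<lambda>(\<phi>, D). {f \<in> M. \<forall>A\<in>\<A>.
    diameter (apply_bfun (f - \<phi>) ` A) \<le> e \<and> apply_bfun f (p A) \<in> D A})"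
  let ?I = "\<Phi> \<times> Pi\<^sub>E \<A> \<D>"
  show "kuratowski M \<le> 2 * e + d"
  proof (rule kuratowski_le[of _ "cell ` ?I"])
    show "0 < 2 * e + d" using e d by simp
    show "finite (cell ` ?I)"
      using fin fin\<D> by (intro finite_imageI finite_cartesian_product finite_PiE)
    show "M \<subseteq> \<Union>(cell ` ?I)"
    proof
      fix f assume f: "f \<in> M"
      then obtain \<phi> where \<phi>: "\<phi> \<in> \<Phi>" "\<And>A. A \<in> \<A> \<Longrightarrow> diameter (apply_bfun (f - \<phi>) ` A) \<le> e"
        using osc by blast
      have "\<exists>D\<in>\<D> A. apply_bfun f (p A) \<in> D" for A
        using cov[of A] f by blast
      then obtain D where D: "\<And>A. D A \<in> \<D> A" "\<And>A. apply_bfun f (p A) \<in> D A"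
        by metis
      have "f \<in> cell (\<phi>, restrict D \<A>)"
        using f \<phi> D by (simp add: cell_def)
      moreover have "(\<phi>, restrict D \<A>) \<in> ?I"
        using \<phi> D by auto
      ultimately show "f \<in> \<Union>(cell ` ?I)" by blast
    qed
    fix C assume "C \<in> cell ` ?I"
    then obtain \<phi> D where D: "D \<in> Pi\<^sub>E \<A> \<D>" and C: "C = cell (\<phi>, D)" by auto
    have "norm (f - g) \<le> 2 * e + d" if f: "f \<in> C" and g: "g \<in> C" for f g
    proof (rule norm_bfun_le)
      fix x
      obtain A where A: "A \<in> \<A>" "x \<in> A"
        using partition_onD1[OF part] by blast
      have osc_le: "dist (apply_bfun (h - \<phi>) x) (apply_bfun (h - \<phi>) (p A)) \<le> e" if "h \<in> C" for h
      proof -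
        have "bounded (apply_bfun (h - \<phi>) ` A)"
          by (rule bounded_subset[OF bounded_range_apply_bfun[of "h - \<phi>"]]) blast
        then have "dist (apply_bfun (h - \<phi>) x) (apply_bfun (h - \<phi>) (p A))
            \<le> diameter (apply_bfun (h - \<phi>) ` A)"
          using A p[OF A(1)] by (intro diameter_bounded_bound) auto
        then show ?thesis using that A(1) by (auto simp: C cell_def)
      qed
      have "dist (apply_bfun f (p A)) (apply_bfun g (p A)) \<le> d"
        using f g A(1) D by (intro small[of "D A" A]) (auto simp: C cell_def)
      \<comment> \<open>In this identity \<open>\<phi>\<close> cancels; two oscillations of at most
        \<open>e\<close> and a difference at the base point of at most \<open>d\<close>
        remain.\<close>
      moreover have "apply_bfun (f - g) x
          = (apply_bfun (f - \<phi>) x - apply_bfun (f - \<phi>) (p A))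
            - (apply_bfun (g - \<phi>) x - apply_bfun (g - \<phi>) (p A))
            + (apply_bfun f (p A) - apply_bfun g (p A))"
        by simp
      ultimately show "norm (apply_bfun (f - g) x) \<le> 2 * e + d"
        using osc_le[OF f] osc_le[OF g] unfolding dist_norm
        by (smt (verit) norm_triangle_ineq norm_triangle_ineq4)
    qed
    then have "diameter C \<le> 2 * e + d"
      using e d by (intro diameter_le) auto
    moreover have "bounded C"
      by (rule bounded_subset[OF M]) (auto simp: C cell_def)
    ultimately show "bounded C \<and> diameter C \<le> 2 * e + d" by simp
  qed
qed

text \<open>Every admissible \<open>e\<close> is at least \<open>kuratowski M / 2\<close>. This
  passes to the infimum once some \<open>e\<close> is admissible: with \<open>\<phi> = 0\<close> and
  a single part, \<open>2 * B\<close> is.\<close>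

lemma kuratowski_le_omega_B:
  fixes M :: "('w, 'y::real_normed_vector) bfun set"
  assumes M: "bounded M" and pc: "pointwise_relatively_compact M"
  shows "kuratowski M \<le> 2 * omega_B M"
proof -
  let ?E = "{\<epsilon>. \<epsilon> > 0 \<and>
    (\<exists>\<A> \<Phi>. finite \<A> \<and> partition_on (UNIV :: 'w set) \<A> \<and> finite (\<Phi> :: ('w, 'y) bfun set) \<and>
      (\<forall>f\<in>M. \<exists>\<phi>\<in>\<Phi>. \<forall>A\<in>\<A>. diameter (apply_bfun (f - \<phi>) ` A) \<le> \<epsilon>))}"
  obtain B where B: "B > 0" "\<And>f. f \<in> M \<Longrightarrow> norm f \<le> B"
    using M unfolding bounded_pos by blast
  have "diameter (apply_bfun f ` UNIV) \<le> 2 * B" if "f \<in> M" for f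
  proof (rule diameter_le)
    fix u v assume "u \<in> range (apply_bfun f)" "v \<in> range (apply_bfun f)"
    then have "norm u \<le> B" "norm v \<le> B"
      using order_trans[OF norm_apply_bfun_le B(2)[OF that]] by blast+
    then show "norm (u - v) \<le> 2 * B"
      using norm_triangle_ineq4[of u v] by simp
  qed (use B in simp)
  moreover have "partition_on UNIV {UNIV :: 'w set}"
    by (auto simp: partition_on_def)
  ultimately have "2 * B \<in> ?E"
    using B(1) by (intro CollectI conjI exI[of _ "{UNIV}"] exI[of _ "{0}"]) auto
  then have "?E \<noteq> {}" by blast
  moreover have "kuratowski M / 2 \<le> e" if "e \<in> ?E" for e
  proof -
    from that obtain \<A> and \<Phi> :: "('w, 'y) bfun set" where "e > 0" "finite \<A>"
      "partition_on (UNIV :: 'w set) \<A>" "finite \<Phi>"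
      and "\<And>f. f \<in> M \<Longrightarrow> \<exists>\<phi>\<in>\<Phi>. \<forall>A\<in>\<A>. diameter (apply_bfun (f - \<phi>) ` A) \<le> e"
      by blast
    then have "kuratowski M \<le> 2 * e"
      by (intro kuratowski_le_partition[OF M pc])
    then show ?thesis by simp
  qed
  ultimately have "kuratowski M / 2 \<le> Inf ?E"
    by (rule cInf_greatest)
  then show ?thesis by (simp add: omega_B_def)
qed

theorem theorem5p1:
  fixes M :: "('w, 'y::banach) bfun set"
  assumes "lindenstrauss_space TYPE('y) TYPE('b)"
    and "M \<noteq> {}" and "bounded M"
    and "pointwise_relatively_compact M"
  shows "omega_B M \<le> kuratowski M \<and> kuratowski M \<le> 2 * omega_B M"
  using assms by (intro conjI lindenstrauss_omega_B_le_kuratowski kuratowski_le_omega_B)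

end
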